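(* Consider the optimal inertia allocation problem stated in the context, for the performance output characterizing the effort of primary control, i.e. $S=D$ and $N=0$. Then this problem can be equivalently restated as the convex problem $$\underset{m\in\mathbb{R}^n}{\text{minimize}}\ \sum_{i=1}^n\frac{v_i}{m_i}\quad\text{subject to}\quad \sum_{i=1}^n m_i\le m_{\mathrm{bdg}},\qquad m_i\in[\underline{m_i},\overline{m_i}],\ i\in\{1,\dots,n\},$$ that is, this problem is convex, and a vector $m$ is the $m$-component of an optimal solution $(m,P)$ of the optimal inertia allocation problem if and only if $m$ is an optimal solution of this problem.
   Context: Setting. Let $n\ge 1$. The power network has nodes $\{1,\dots,n\}$ and symmetric susceptances $b_{ij}=b_{ji}\ge 0$ ($i\ne j$); $L\in\mathbb{R}^{n\times n}$ is the corresponding weighted graph Laplacian, with off-diagonal entries $-b_{ij}$ and diagonal entries $\sum_{j\ne i}b_{ij}$. The network graph (edges $\{i,j\}$ with $b_{ij}>0$) is connected. The nodes have inertia coefficients $m_i>0$ and damping coefficients $d_i>0$, and $M=\operatorname{diag}\{m_i\}$, $D=\operatorname{diag}\{d_i\}$. Disturbance strengths are $v_i\ge 0$ (describing the strength of the disturbance at node $i$), and $V=\operatorname{diag}\{v_i\}$. The linear system $\mathscr{G}=(A,B,C)$ has state $(\theta,\omega)\in\mathbb{R}^{2n}$, input $\eta$ and output $y$, with $$A=\begin{bmatrix}0&I\\ -M^{-1}L&-M^{-1}D\end{bmatrix},\quad B=\begin{bmatrix}0\\ M^{-1}V^{1/2}\end{bmatrix},\quad C=\begin{bmatrix}N^{1/2}&0\\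 0&S^{1/2}\end{bmatrix},$$ where $N$ and $S$ are positive semidefinite penalty matrices ($S$ diagonal); here $N=0$ and $S=D$, corresponding to the cost $\int_0^\infty\dot\theta(t)^{\mathsf T}D\dot\theta(t)\,dt$. The squared $\mathscr{H}_2$ norm is $\|\mathscr{G}\|_2^2=\int_0^\infty \operatorname{Trace}\big(B^{\mathsf T}e^{A^{\mathsf T}t}C^{\mathsf T}Ce^{At}B\big)\,dt$. Let $z_0\in\mathbb{R}^{2n}$ be the vector whose first $n$ entries are $1$ and whose last $n$ entries are $0$. Optimal inertia allocation problem: given bounds $0<\underline{m_i}\le\overline{m_i}$ and a budget $m_{\mathrm{bdg}}$, minimize over $m\in\mathbb{R}^n$ and $P\in\mathbb{R}^{2n\times 2n}$ the objective $\|\mathscr{G}\|_2^2=\operatorname{Trace}(B^{\mathsf T}PB)$ subject to $\sum_{i}m_i\le m_{\mathrm{bdg}}$, $m_i\in[\underline{m_i},\overline{m_i}]$ for all $i$, $PA+A^{\mathsf T}P+C^{\mathsf T}C=0$ and $Pz_0=0$ (where $A,B$ depend on $m$). *)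

theory Defs
  imports "HOL-Analysis.Analysis"
begin

definition diag_mat :: "real^'n \<Rightarrow> real^'n^'n" where
  "diag_mat x = (\<chi> i j. if i = j then x $ i else 0)"

definition pos_semidef :: "real^'n^'n \<Rightarrow> bool" where
  "pos_semidef R \<longleftrightarrow> transpose R = R \<and> (\<forall>x. 0 \<le> x \<bullet> (R *v x))"

text \<open>The square root is only meaningful for a positive semidefinite argument, in which case
  the positive semidefinite root is unique.\<close>

definition matrix_sqrt :: "real^'n^'n \<Rightarrow> real^'n^'n" where
  "matrix_sqrt X = (THE R. pos_semidef R \<and> R ** R = X)"

definition matrix_exp :: "real^'n^'n \<Rightarrow> real^'n^'n" where
  "matrix_exp X = (\<Sum>k. (1 / fact k) *\<^sub>R (((\<lambda>Y. X ** Y) ^^ k) (mat 1)))"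

text \<open>Vectors of length $2n$ are indexed by the disjoint sum of two copies of the node type:
  \<open>Inl\<close> indexes the angles and \<open>Inr\<close> the frequencies.\<close>

definition block_mat ::
  "real^'n^'n \<Rightarrow> real^'n^'n \<Rightarrow> real^'n^'n \<Rightarrow> real^'n^'n \<Rightarrow> real^('n + 'n)^('n + 'n)" where
  "block_mat P Q R S = (\<chi> i j. case i of
      Inl k \<Rightarrow> (case j of Inl l \<Rightarrow> P $ k $ l | Inr l \<Rightarrow> Q $ k $ l)
    | Inr k \<Rightarrow> (case j of Inl l \<Rightarrow> R $ k $ l | Inr l \<Rightarrow> S $ k $ l))"

definition block_col :: "real^'p^'n \<Rightarrow> real^'p^'n \<Rightarrow> real^'p^('n + 'n)" where
  "block_col P Q = (\<chi> i j. case i of Inl k \<Rightarrow> P $ k $ j | Inr k \<Rightarrow> Q $ k $ j)"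

text \<open>The values \<open>b i i\<close> are never used.\<close>

definition laplacian :: "('n::finite \<Rightarrow> 'n \<Rightarrow> real) \<Rightarrow> real^'n^'n" where
  "laplacian b = (\<chi> i j. if i = j then (\<Sum>k\<in>UNIV - {i}. b i k) else - b i j)"

definition network_connected :: "('n \<Rightarrow> 'n \<Rightarrow> real) \<Rightarrow> bool" where
  "network_connected b \<longleftrightarrow> (\<forall>i j. (\<lambda>k l. k \<noteq> l \<and> b k l > 0)\<^sup>*\<^sup>* i j)"

definition sys_A :: "('n::finite \<Rightarrow> 'n \<Rightarrow> real) \<Rightarrow> real^'n \<Rightarrow> real^'n \<Rightarrow> real^('n + 'n)^('n + 'n)" where
  "sys_A b d m = block_mat 0 (mat 1)
     (- (matrix_inv (diag_mat m) ** laplacian b))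
     (- (matrix_inv (diag_mat m) ** diag_mat d))"

definition sys_B :: "real^'n \<Rightarrow> real^'n \<Rightarrow> real^'n^('n + 'n)" where
  "sys_B v m = block_col 0 (matrix_inv (diag_mat m) ** matrix_sqrt (diag_mat v))"

definition sys_C :: "real^'n^'n \<Rightarrow> real^'n^'n \<Rightarrow> real^('n + 'n)^('n + 'n)" where
  "sys_C N S = block_mat (matrix_sqrt N) 0 0 (matrix_sqrt S)"

definition z0 :: "real^('n::finite + 'n)" where
  "z0 = (\<chi> i. case i of Inl _ \<Rightarrow> 1 | Inr _ \<Rightarrow> 0)"

definition h2_integrand ::
  "real^'k^'k \<Rightarrow> real^'p^'k \<Rightarrow> real^'k^'q \<Rightarrow> real \<Rightarrow> real" where
  "h2_integrand A B C t = trace (transpose B ** matrix_exp (t *\<^sub>R transpose A)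
     ** transpose C ** C ** matrix_exp (t *\<^sub>R A) ** B)"

definition h2_norm_sq :: "real^'k^'k \<Rightarrow> real^'p^'k \<Rightarrow> real^'k^'q \<Rightarrow> real" where
  "h2_norm_sq A B C = integral {0..} (h2_integrand A B C)"

definition inertia_set :: "real^'n \<Rightarrow> real^'n \<Rightarrow> real \<Rightarrow> (real^'n) set" where
  "inertia_set lo hi bdg =
     {m. (\<Sum>i\<in>UNIV. m $ i) \<le> bdg \<and> (\<forall>i. m $ i \<in> {lo $ i..hi $ i})}"

definition allocation_feasible ::
  "('n::finite \<Rightarrow> 'n \<Rightarrow> real) \<Rightarrow> real^'n \<Rightarrow> real^'n^'n \<Rightarrow> real^'n^'n \<Rightarrow> real^'n \<Rightarrow> real^'n \<Rightarrow> real
    \<Rightarrow> ((real^'n) \<times> (real^('n + 'n)^('n + 'n))) set" where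
  "allocation_feasible b d N S lo hi bdg =
     {(m, P). m \<in> inertia_set lo hi bdg
        \<and> P ** sys_A b d m + transpose (sys_A b d m) ** P + transpose (sys_C N S) ** sys_C N S = 0
        \<and> P *v z0 = 0}"

definition allocation_objective ::
  "real^'n \<Rightarrow> (real^'n) \<times> (real^('n + 'n)^('n + 'n)) \<Rightarrow> real" where
  "allocation_objective v = (\<lambda>(m, P). trace (transpose (sys_B v m) ** P ** sys_B v m))"

definition reduced_objective :: "real^'n \<Rightarrow> real^'n \<Rightarrow> real" where
  "reduced_objective v m = (\<Sum>i\<in>UNIV. v $ i / m $ i)"

end

theory Submission imports Defs begin

text \<open>With \<open>H\<close> the block diagonal matrix of \<open>L\<close> and \<open>M\<close>, the total energy matrix \<open>H / 2\<close> solves the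
  observability Lyapunov equation because the output penalizes exactly the damping losses, and
  it gives \<open>Trace(B\<^sup>T H B) / 2 = (\<Sum>i. v\<^sub>i / m\<^sub>i) / 2\<close>. For any feasible \<open>P\<close>, integrating the
  Lyapunov equation along trajectories expresses \<open>Trace(B\<^sup>T P B)\<close> as the H2 integral, because
  \<open>x(t) \<bullet> P x(t) \<longlonglongrightarrow> 0\<close>: the energy tends to \<open>0\<close>, connectedness turns this into consensus
  of the angles, and \<open>P\<close> annihilates the consensus direction. Hence all feasible \<open>P\<close> have the
  objective value of \<open>H / 2\<close>.\<close>

subsection \<open>The matrix exponential\<close>

text \<open>A row sum of \<open>A\<close> times a bound on the previous power bounds the next one.
  Replacing the row sum by the total sum \<open>?K\<close> makes the bound geometric, which is what
  dominates the exponential series.\<close>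

lemma matrix_power_entry_bound:
  fixes A :: "real^'n^'n"
  shows "\<bar>((\<lambda>Y. A ** Y) ^^ k) (mat 1) $ i $ j\<bar> \<le> (\<Sum>i\<in>UNIV. \<Sum>j\<in>UNIV. \<bar>A $ i $ j\<bar>) ^ k"
proof (induction k arbitrary: i)
  case 0
  show ?case by (simp add: mat_def)
next
  case (Suc k)
  let ?K = "\<Sum>i\<in>UNIV. \<Sum>j\<in>UNIV. \<bar>A $ i $ j\<bar>"
  let ?Y = "((\<lambda>Y. A ** Y) ^^ k) (mat 1)"
  have K: "0 \<le> ?K" by (intro sum_nonneg) auto
  have "\<bar>(\<Sum>l\<in>UNIV. A $ i $ l * ?Y $ l $ j)\<bar> \<le> (\<Sum>l\<in>UNIV. \<bar>A $ i $ l\<bar> * ?K ^ k)"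
    by (rule order_trans[OF sum_abs]) (auto intro!: sum_mono mult_left_mono Suc simp: abs_mult)
  also have "\<dots> = (\<Sum>l\<in>UNIV. \<bar>A $ i $ l\<bar>) * ?K ^ k"
    by (simp add: sum_distrib_right)
  also have "\<dots> \<le> ?K * ?K ^ k"
    using K by (intro mult_right_mono member_le_sum) (auto intro: sum_nonneg)
  finally show ?case by (simp add: matrix_matrix_mult_def)
qed

lemma matrix_power_scaleR:
  fixes A :: "real^'n^'n"
  shows "((\<lambda>Y. (t *\<^sub>R A) ** Y) ^^ k) (mat 1) = t ^ k *\<^sub>R ((\<lambda>Y. A ** Y) ^^ k) (mat 1)"
  by (induction k)
    (auto simp: matrix_scalar_ac scalar_matrix_assoc[symmetric])

lemma matrix_power_commute:
  fixes A :: "real^'n^'n"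
  shows "((\<lambda>Y. A ** Y) ^^ k) (mat 1) ** A = A ** ((\<lambda>Y. A ** Y) ^^ k) (mat 1)"
  by (induction k) (auto simp: matrix_mul_assoc[symmetric])

lemma matrix_power_transpose:
  fixes A :: "real^'n^'n"
  shows "((\<lambda>Y. transpose A ** Y) ^^ k) (mat 1) = transpose (((\<lambda>Y. A ** Y) ^^ k) (mat 1))"
proof (induction k)
  case (Suc k)
  then show ?case
    by (simp add: matrix_transpose_mul[symmetric] matrix_power_commute)
qed simp

text \<open>The terms are written as fixed coefficients times \<open>t ^ k\<close>, so that each
  entry is a real power series in \<open>t\<close> and can be differentiated termwise. The
  comparison series is that of the exponential at \<open>?K * \<bar>t\<bar>\<close>.\<close>

lemma matrix_exp_entry_summable:
  fixes A :: "real^'n^'n"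
  shows "summable (\<lambda>k. ((\<lambda>Y. A ** Y) ^^ k) (mat 1) $ i $ j / fact k * t ^ k)"
proof (rule summable_comparison_test')
  let ?K = "\<Sum>i\<in>UNIV. \<Sum>j\<in>UNIV. \<bar>A $ i $ j\<bar>"
  show "summable (\<lambda>k. inverse (fact k) * (?K * \<bar>t\<bar>) ^ k)"
    by (rule summable_exp)
  show "norm (((\<lambda>Y. A ** Y) ^^ k) (mat 1) $ i $ j / fact k * t ^ k)
      \<le> inverse (fact k) * (?K * \<bar>t\<bar>) ^ k" for k
    using mult_right_mono[OF matrix_power_entry_bound[where A = A and k = k and i = i and j = j],
        of "\<bar>t\<bar> ^ k"]
    by (simp add: abs_mult power_mult_distrib power_abs divide_simps mult.commute)
qed

lemma matrix_exp_entry: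
  fixes A :: "real^'n^'n"
  shows "matrix_exp (t *\<^sub>R A) $ i $ j
    = (\<Sum>k. ((\<lambda>Y. A ** Y) ^^ k) (mat 1) $ i $ j / fact k * t ^ k)"
proof -
  let ?c = "\<lambda>i j k. ((\<lambda>Y. A ** Y) ^^ k) (mat 1) $ i $ j / fact k * t ^ k"
  have "(\<lambda>k. (1 / fact k) *\<^sub>R ((\<lambda>Y. (t *\<^sub>R A) ** Y) ^^ k) (mat 1))
      sums (\<chi> i j. \<Sum>k. ?c i j k)"
    \<comment> \<open>Convergence of the matrix series is reduced to that of its finitely many
      entries.\<close>
    unfolding sums_def
  proof (intro vec_tendstoI)
    fix i j
    show "(\<lambda>n. (\<Sum>k<n. (1 / fact k) *\<^sub>R ((\<lambda>Y. (t *\<^sub>R A) ** Y) ^^ k) (mat 1)) $ i $ j)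
        \<longlonglongrightarrow> (\<chi> i j. \<Sum>k. ?c i j k) $ i $ j"
      using summable_LIMSEQ[OF matrix_exp_entry_summable[of A i j t]]
      by (simp add: matrix_power_scaleR mult.commute)
  qed
  then have "matrix_exp (t *\<^sub>R A) = (\<chi> i j. \<Sum>k. ?c i j k)"
    unfolding matrix_exp_def by (rule sums_unique[symmetric])
  then show ?thesis by simp
qed

lemma matrix_exp_transpose:
  fixes A :: "real^'n^'n"
  shows "matrix_exp (t *\<^sub>R transpose A) = transpose (matrix_exp (t *\<^sub>R A))"
  by (simp add: vec_eq_iff matrix_exp_entry matrix_power_transpose)
    (simp add: transpose_def matrix_exp_entry)

lemma matrix_exp_0: "matrix_exp (0 :: real^'n^'n) = mat 1"
proof -
  have "matrix_exp (0 *\<^sub>R (0 :: real^'n^'n)) $ i $ j = mat 1 $ i $ j" for i j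
    unfolding matrix_exp_entry powser_zero by simp
  then show ?thesis by (simp add: vec_eq_iff)
qed

text \<open>The factorial absorbs the index produced by differentiation and one factor
  \<open>A\<close> is left over; the finite sum of the matrix product with \<open>A\<close> then
  commutes with the series.\<close>

lemma matrix_exp_entry_deriv:
  fixes A :: "real^'n^'n"
  shows "((\<lambda>t. matrix_exp (t *\<^sub>R A) $ i $ j)
    has_real_derivative (A ** matrix_exp (t *\<^sub>R A)) $ i $ j) (at t)"
proof -
  let ?a = "\<lambda>i j k. ((\<lambda>Y. A ** Y) ^^ k) (mat 1) $ i $ j / fact k"
  have "diffs (?a i j) k = (\<Sum>l\<in>UNIV. A $ i $ l * ?a l j k)" for k
  proof -
    have "diffs (?a i j) k = (A ** ((\<lambda>Y. A ** Y) ^^ k) (mat 1)) $ i $ j / fact k"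
      by (simp add: diffs_def del: of_nat_Suc)
    then show ?thesis
      by (simp add: matrix_matrix_mult_def[of A "((\<lambda>Y. A ** Y) ^^ k) (mat 1)"] sum_divide_distrib)
  qed
  then have "(\<Sum>k. diffs (?a i j) k * t ^ k) = (\<Sum>k. \<Sum>l\<in>UNIV. A $ i $ l * (?a l j k * t ^ k))"
    by (simp add: sum_distrib_right sum_distrib_left mult.assoc)
  also have "\<dots> = (\<Sum>l\<in>UNIV. \<Sum>k. A $ i $ l * (?a l j k * t ^ k))"
    by (intro suminf_sum summable_mult matrix_exp_entry_summable)
  also have "\<dots> = (A ** matrix_exp (t *\<^sub>R A)) $ i $ j"
    by (simp only: suminf_mult[OF matrix_exp_entry_summable] matrix_exp_entry[symmetric])
      (simp add: matrix_matrix_mult_def[of A "matrix_exp (t *\<^sub>R A)"])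
  finally show ?thesis
    using termdiffs_strong_converges_everywhere[OF matrix_exp_entry_summable[of A i j], of t]
    by (simp add: matrix_exp_entry)
qed

lemma matrix_exp_flow_deriv:
  fixes A :: "real^'n^'n"
  shows "((\<lambda>t. matrix_exp (t *\<^sub>R A) *v y)
    has_vector_derivative A *v (matrix_exp (t *\<^sub>R A) *v y)) (at t)"
proof -
  have "((\<lambda>t. (matrix_exp (t *\<^sub>R A) *v y) $ i)
      has_real_derivative (A *v (matrix_exp (t *\<^sub>R A) *v y)) $ i) (at t)" for i
    unfolding matrix_vector_mul_assoc
    unfolding matrix_vector_mult_def
    by (auto intro!: derivative_eq_intros matrix_exp_entry_deriv)
  then show ?thesis
    unfolding has_vector_derivative_def has_field_derivative_def
    by (subst has_derivative_componentwise_within)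
     (auto simp: Basis_vec_def inner_axis mult_commute_abs)
qed

subsection \<open>Quadratic forms along a linear flow\<close>

text \<open>No symmetry of \<open>P\<close> is built in, because the allocation problem does not
  require a feasible \<open>P\<close> to be symmetric.\<close>

definition quad_form :: "real^'n^'n \<Rightarrow> real^'n \<Rightarrow> real" where
  "quad_form P x = x \<bullet> (P *v x)"

lemma quad_form_zero [simp]: "quad_form 0 x = 0"
  by (simp add: quad_form_def)

lemma quad_form_scaleR: "quad_form (c *\<^sub>R P) x = c * quad_form P x"
  by (simp add: quad_form_def scaleR_matrix_vector_assoc[symmetric])

lemma quad_form_minus: "quad_form (- P) x = - quad_form P x"
  using quad_form_scaleR[of "-1" P x] by simp

lemma quad_form_sum: "quad_form P x = (\<Sum>i\<in>UNIV. \<Sum>j\<in>UNIV. P $ i $ j * (x $ i * x $ j))"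
  by (simp add: quad_form_def inner_vec_def matrix_vector_mult_def sum_distrib_left mult_ac)

lemma quad_form_diag: "quad_form (diag_mat a) x = (\<Sum>i\<in>UNIV. a $ i * (x $ i)\<^sup>2)"
  by (simp add: quad_form_sum diag_mat_def if_distrib[of "\<lambda>c. c * _"] power2_eq_square cong: if_cong)

lemma quad_form_flow_deriv:
  assumes "(X has_vector_derivative A *v X t) (at t)"
  shows "((\<lambda>t. quad_form P (X t)) has_real_derivative
    quad_form (P ** A + transpose A ** P) (X t)) (at t)"
proof -
  have "((\<lambda>t. P *v X t) has_vector_derivative P *v (A *v X t)) (at t)"
    by (rule bounded_linear.has_vector_derivative[OF matrix_vector_mul_bounded_linear assms])
  then have "((\<lambda>t. X t \<bullet> (P *v X t)) has_vector_derivative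
      X t \<bullet> (P *v (A *v X t)) + (A *v X t) \<bullet> (P *v X t)) (at t)"
    by (rule bounded_bilinear.has_vector_derivative[OF bounded_bilinear_inner assms])
  moreover have "(A *v X t) \<bullet> (P *v X t) = X t \<bullet> ((transpose A ** P) *v X t)"
    by (metis dot_lmul_matrix inner_commute matrix_vector_mul_assoc transpose_matrix_vector)
  ultimately show ?thesis
    by (simp add: quad_form_def has_real_derivative_iff_has_vector_derivative
        matrix_vector_mult_add_rdistrib inner_add_right matrix_vector_mul_assoc)
qed

text \<open>This turns the trace into a sum over initial states: each column of \<open>B\<close>
  starts one trajectory, which can be studied separately.\<close>

lemma trace_congruence:
  fixes B :: "real^'p^'k" and P :: "real^'k^'k"
  shows "trace (transpose B ** P ** B) = (\<Sum>j\<in>UNIV. quad_form P (column j B))"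
  unfolding trace_def
proof (intro sum.cong refl)
  fix j
  have "(transpose B ** P ** B) $ j $ j = (\<Sum>k\<in>UNIV. \<Sum>l\<in>UNIV. B $ l $ j * P $ l $ k * B $ k $ j)"
    by (simp add: matrix_matrix_mult_def transpose_def sum_distrib_right)
  also have "\<dots> = quad_form P (column j B)"
    by (subst sum.swap) (simp add: quad_form_sum column_def mult_ac)
  finally show "(transpose B ** P ** B) $ j $ j = quad_form P (column j B)" .
qed

lemma column_matrix_mult: "column j (A ** B) = A *v column j B"
  by (simp add: vec_eq_iff column_def matrix_matrix_mult_def matrix_vector_mult_def)

lemma h2_integrand_eq:
  "h2_integrand A B C t
    = (\<Sum>j\<in>UNIV. quad_form (transpose C ** C) (matrix_exp (t *\<^sub>R A) *v column j B))"
proof -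
  have "h2_integrand A B C t = trace (transpose (matrix_exp (t *\<^sub>R A) ** B)
      ** (transpose C ** C) ** (matrix_exp (t *\<^sub>R A) ** B))"
    by (simp add: h2_integrand_def matrix_exp_transpose matrix_transpose_mul matrix_mul_assoc)
  then show ?thesis by (simp add: trace_congruence column_matrix_mult)
qed

text \<open>By the Lyapunov equation, minus the form of \<open>P\<close> along the trajectory is an
  antiderivative of the form of \<open>Q\<close>. The boundary term at infinity vanishes by
  \<open>lim\<close>, which leaves the value at \<open>y\<close>.\<close>

lemma lyapunov_has_integral:
  fixes A P Q :: "real^'k^'k"
  assumes lyap: "P ** A + transpose A ** P + Q = 0"
    and nonneg: "\<And>x. 0 \<le> quad_form Q x"
    and lim: "((\<lambda>t. quad_form P (matrix_exp (t *\<^sub>R A) *v y)) \<longlongrightarrow> 0) at_top"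
  shows "((\<lambda>t. quad_form Q (matrix_exp (t *\<^sub>R A) *v y)) has_integral quad_form P y) {0..}"
proof -
  let ?X = "\<lambda>t. matrix_exp (t *\<^sub>R A) *v y"
  have Q: "P ** A + transpose A ** P = - Q"
    using lyap by (simp add: add_eq_0_iff)
  have deriv: "((\<lambda>t. - quad_form P (?X t)) has_real_derivative quad_form Q (?X t)) (at t)" for t
    using DERIV_minus[OF quad_form_flow_deriv[where P = P, OF matrix_exp_flow_deriv[of A y t]]]
    by (simp add: Q quad_form_minus)
  have int: "((\<lambda>t. quad_form Q (?X t)) has_integral quad_form P y - quad_form P (?X s)) {0..s}"
    if "0 \<le> s" for s
    using fundamental_theorem_of_calculus[OF that,
        of "\<lambda>t. - quad_form P (?X t)" "\<lambda>t. quad_form Q (?X t)"]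
      deriv
    by (auto simp: has_real_derivative_iff_has_vector_derivative[symmetric]
        has_field_derivative_at_within matrix_exp_0)
  show ?thesis
  \<comment> \<open>Nonnegativity of the integrand upgrades the limit of the integrals over
    \<open>{0..s}\<close> to integrability on the half line.\<close>
  proof (rule has_integral_to_inf)
    show "(\<lambda>t. quad_form Q (?X t)) integrable_on {0..s}" for s
      using int[of s] by (cases "0 \<le> s") (auto simp: integrable_on_def)
    have "((\<lambda>s. quad_form P y - quad_form P (?X s)) \<longlongrightarrow> quad_form P y - 0) at_top"
      by (intro tendsto_intros lim)
    moreover have "\<forall>\<^sub>F s in at_top. quad_form P y - quad_form P (?X s)
        = integral {0..s} (\<lambda>t. quad_form Q (?X t))"
      using eventually_ge_at_top[of 0] by eventually_elim (simp add: integral_unique[OF int])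
    ultimately show "((\<lambda>s. integral {0..s} (\<lambda>t. quad_form Q (?X t))) \<longlongrightarrow> quad_form P y) at_top"
      by (simp add: Lim_transform_eventually)
  qed (simp add: nonneg)
qed

subsection \<open>Diagonal, block and Laplacian matrices\<close>

lemma diag_mat_mult_left: "(diag_mat a ** R) $ i $ j = a $ i * R $ i $ j"
  by (simp add: matrix_matrix_mult_def diag_mat_def if_distrib[of "\<lambda>c. c * _"] cong: if_cong)

lemma diag_mat_mult: "diag_mat a ** diag_mat c = diag_mat (\<chi> i. a $ i * c $ i)"
  by (simp add: vec_eq_iff diag_mat_mult_left) (simp add: diag_mat_def)

lemma transpose_diag_mat [simp]: "transpose (diag_mat a) = diag_mat a"
  by (auto simp: vec_eq_iff transpose_def diag_mat_def)

lemma diag_mat_one: "diag_mat (\<chi> i. 1) = mat 1"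
  by (simp add: vec_eq_iff diag_mat_def mat_def)

lemma diag_mat_zero: "diag_mat 0 = 0"
  by (simp add: diag_mat_def vec_eq_iff)

lemma matrix_inv_diag_mat:
  fixes a :: "real^'n"
  assumes "\<And>i. a $ i \<noteq> 0"
  shows "matrix_inv (diag_mat a) = diag_mat (\<chi> i. 1 / a $ i)"
proof -
  let ?a' = "diag_mat (\<chi> i. 1 / a $ i)"
  have right: "diag_mat a ** ?a' = mat 1" and left: "?a' ** diag_mat a = mat 1"
    by (simp_all add: diag_mat_mult assms diag_mat_one)
  \<comment> \<open>\<open>matrix_inv\<close> is a choice among inverses, so only the defining
    property is available; cancelling with the known left inverse identifies it.\<close>
  have "diag_mat a ** matrix_inv (diag_mat a) = mat 1"
    unfolding matrix_inv_def by (rule someI2[where a = ?a']) (auto simp: left right)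
  then show ?thesis
    by (metis left matrix_mul_assoc matrix_mul_lid matrix_mul_rid)
qed

lemma diag_mat_axis: "diag_mat a *v axis i 1 = a $ i *\<^sub>R (axis i 1 :: real^'n)"
  by (simp add: matrix_vector_mult_basis) (auto simp: vec_eq_iff column_def diag_mat_def axis_def)

text \<open>Any positive semidefinite root \<open>R\<close> acts on the \<open>i\<close>-th basis vector as the scalar
  \<open>s = sqrt (a $ i)\<close>: the vector \<open>w = (R - s) e\<^sub>i\<close> satisfies \<open>R w = - s w\<close>, which forces
  \<open>w = 0\<close> when \<open>s > 0\<close>, while \<open>s = 0\<close> gives \<open>\<parallel>R e\<^sub>i\<parallel>\<^sup>2 = e\<^sub>i \<bullet> R\<^sup>2 e\<^sub>i = 0\<close>.\<close>

lemma matrix_sqrt_diag_mat: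
  fixes a :: "real^'n"
  assumes nonneg: "\<And>i. 0 \<le> a $ i"
  shows "matrix_sqrt (diag_mat a) = diag_mat (\<chi> i. sqrt (a $ i))"
  unfolding matrix_sqrt_def
proof (rule the_equality)
  show "pos_semidef (diag_mat (\<chi> i. sqrt (a $ i)))
      \<and> diag_mat (\<chi> i. sqrt (a $ i)) ** diag_mat (\<chi> i. sqrt (a $ i)) = diag_mat a"
    using nonneg
    by (auto simp: pos_semidef_def diag_mat_mult quad_form_def[symmetric] quad_form_diag
        intro!: sum_nonneg)
next
  fix R assume "pos_semidef R \<and> R ** R = diag_mat a"
  then have sym: "transpose R = R" and psd: "\<And>x. 0 \<le> x \<bullet> (R *v x)" and sq: "R ** R = diag_mat a"
    by (auto simp: pos_semidef_def)
  have "R *v axis i 1 = sqrt (a $ i) *\<^sub>R axis i 1" for i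
  proof -
    let ?e = "axis i 1 :: real^'n" and ?s = "sqrt (a $ i)"
    have RR: "R *v (R *v ?e) = (?s * ?s) *\<^sub>R ?e"
      using nonneg by (simp add: matrix_vector_mul_assoc sq diag_mat_axis)
    show ?thesis
    proof (cases "a $ i = 0")
      case True
      have "(R *v ?e) \<bullet> (R *v ?e) = ?e \<bullet> (R *v (R *v ?e))"
        by (metis dot_lmul_matrix sym transpose_matrix_vector)
      then show ?thesis using RR True by simp
    next
      case False
      then have s: "0 < ?s" using nonneg[of i] by simp
      let ?w = "R *v ?e - ?s *\<^sub>R ?e"
      have "R *v ?w = - ?s *\<^sub>R ?w"
        by (simp add: matrix_vector_mult_diff_distrib matrix_vector_mult_scaleR RR
            scaleR_diff_right)
      then have "?s * (?w \<bullet> ?w) \<le> 0" using psd[of ?w] by simp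
      then have "?w \<bullet> ?w = 0"
        using s by (metis inner_ge_zero mult_le_0_iff not_le order_antisym)
      then show ?thesis by simp
    qed
  qed
  then have "column i R = column i (diag_mat (\<chi> i. sqrt (a $ i)))" for i
    by (simp add: matrix_vector_mult_basis[symmetric] diag_mat_axis)
  then show "R = diag_mat (\<chi> i. sqrt (a $ i))"
    by (simp add: vec_eq_iff column_def)
qed

lemma matrix_sqrt_zero: "matrix_sqrt (0 :: real^'n^'n) = 0"
  using matrix_sqrt_diag_mat[of "0 :: real^'n"]
  by (simp add: diag_mat_zero) (simp add: diag_mat_def vec_eq_iff)

lemma sum_UNIV_sum: "(\<Sum>i\<in>UNIV. f i) = (\<Sum>k\<in>UNIV. f (Inl k)) + (\<Sum>k\<in>UNIV. f (Inr k))"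
  for f :: "'a::finite + 'b::finite \<Rightarrow> real"
  using sum.Plus[of UNIV UNIV f] by simp

lemma block_mat_mult:
  "block_mat P Q R S ** block_mat P' Q' R' S'
    = block_mat (P ** P' + Q ** R') (P ** Q' + Q ** S') (R ** P' + S ** R') (R ** Q' + S ** S')"
  by (simp add: vec_eq_iff block_mat_def matrix_matrix_mult_def sum_UNIV_sum split: sum.split)

lemma block_mat_add:
  "block_mat P Q R S + block_mat P' Q' R' S' = block_mat (P + P') (Q + Q') (R + R') (S + S')"
  by (simp add: vec_eq_iff block_mat_def split: sum.split)

lemma transpose_block_mat:
  "transpose (block_mat P Q R S)
    = block_mat (transpose P) (transpose R) (transpose Q) (transpose S)"
  by (simp add: vec_eq_iff block_mat_def transpose_def split: sum.split)

lemma quad_form_block_mat: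
  "quad_form (block_mat P Q R S) x
    = quad_form P (\<chi> k. x $ Inl k) + (\<chi> k. x $ Inl k) \<bullet> (Q *v (\<chi> k. x $ Inr k))
      + (\<chi> k. x $ Inr k) \<bullet> (R *v (\<chi> k. x $ Inl k)) + quad_form S (\<chi> k. x $ Inr k)"
  by (simp add: quad_form_def inner_vec_def matrix_vector_mult_def block_mat_def sum_UNIV_sum
      sum.distrib algebra_simps)

lemma transpose_zero: "transpose 0 = 0"
  by (simp add: vec_eq_iff transpose_def)

lemma transpose_uminus: "transpose (- R) = - transpose R" for R :: "real^'m^'n"
  by (simp add: vec_eq_iff transpose_def)

lemma matrix_mult_minus_right: "P ** (- R) = - (P ** R)" for P :: "real^'m^'n"
  by (simp add: vec_eq_iff matrix_matrix_mult_def sum_negf)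

section \<open>The graph Laplacian as a sum over edges\<close>

lemma transpose_laplacian:
  assumes "\<And>i j. i \<noteq> j \<Longrightarrow> b i j = b j i"
  shows "transpose (laplacian b) = laplacian b"
  using assms by (auto simp: vec_eq_iff transpose_def laplacian_def)

lemma laplacian_row_sum: "(\<Sum>j\<in>UNIV. laplacian b $ i $ j) = 0"
  by (subst sum.remove[of _ i]) (simp_all add: laplacian_def sum_negf)

context
  fixes b :: "'n::finite \<Rightarrow> 'n \<Rightarrow> real"
  assumes b_sym: "\<And>i j. i \<noteq> j \<Longrightarrow> b i j = b j i"
    and b_nonneg: "\<And>i j. i \<noteq> j \<Longrightarrow> 0 \<le> b i j"
begin

text \<open>Vanishing row sums give the form as a sum of
  \<open>b i j * ((x $ i)\<^sup>2 - x $ i * x $ j)\<close>. Exchanging \<open>i\<close> and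
  \<open>j\<close> and adding the two versions completes the square.\<close>

lemma quad_form_laplacian:
  "quad_form (laplacian b) x
    = (\<Sum>i\<in>UNIV. \<Sum>j\<in>UNIV - {i}. b i j * (x $ i - x $ j)\<^sup>2) / 2"
proof -
  \<comment> \<open>The diagonal of \<open>b\<close> is arbitrary; setting it to 0 allows sums over
    all pairs, where the order of summation can be exchanged.\<close>
  let ?c = "\<lambda>i j. if i = j then 0 else b i j"
  have c: "?c i j = ?c j i" for i j using b_sym[of i j] by auto
  have off: "(\<Sum>j\<in>UNIV - {i}. b i j * g j) = (\<Sum>j\<in>UNIV. ?c i j * g j)" for i g
    by (rule sum.mono_neutral_cong_left) auto
  have "(\<Sum>j\<in>UNIV. laplacian b $ i $ j * (x $ i * x $ j))
      = (\<Sum>j\<in>UNIV - {i}. b i j * ((x $ i)\<^sup>2 - x $ i * x $ j))" for i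
    by (subst sum.remove[of _ i])
      (simp_all add: laplacian_def power2_eq_square sum_distrib_left sum_distrib_right
        sum.distrib[symmetric] algebra_simps)
  then have 1: "quad_form (laplacian b) x = (\<Sum>i\<in>UNIV. \<Sum>j\<in>UNIV. ?c i j * ((x $ i)\<^sup>2 - x $ i * x $ j))"
    by (simp add: quad_form_sum off)
  also have "\<dots> = (\<Sum>i\<in>UNIV. \<Sum>j\<in>UNIV. ?c i j * ((x $ j)\<^sup>2 - x $ i * x $ j))"
    by (subst sum.swap, intro sum.cong refl) (simp add: c mult.commute)
  finally have 2: "quad_form (laplacian b) x = \<dots>" .
  have "2 * quad_form (laplacian b) x
      = (\<Sum>i\<in>UNIV. \<Sum>j\<in>UNIV. ?c i j * ((x $ i)\<^sup>2 - x $ i * x $ j))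
      + (\<Sum>i\<in>UNIV. \<Sum>j\<in>UNIV. ?c i j * ((x $ j)\<^sup>2 - x $ i * x $ j))"
    using 1 2 by linarith
  also have "\<dots> = (\<Sum>i\<in>UNIV. \<Sum>j\<in>UNIV. ?c i j * (x $ i - x $ j)\<^sup>2)"
    unfolding sum.distrib[symmetric]
    by (intro sum.cong refl) (simp add: power2_eq_square algebra_simps)
  finally show ?thesis by (simp add: off)
qed

lemma quad_form_laplacian_nonneg: "0 \<le> quad_form (laplacian b) x"
  unfolding quad_form_laplacian
  by (auto intro!: sum_nonneg mult_nonneg_nonneg b_nonneg)

lemma edge_le_quad_form_laplacian:
  assumes "k \<noteq> l"
  shows "b k l * (x $ k - x $ l)\<^sup>2 \<le> 2 * quad_form (laplacian b) x"
proof -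
  have "b k l * (x $ k - x $ l)\<^sup>2 \<le> (\<Sum>j\<in>UNIV - {k}. b k j * (x $ k - x $ j)\<^sup>2)"
    using assms by (intro member_le_sum) (auto simp: b_nonneg)
  also have "\<dots> \<le> (\<Sum>i\<in>UNIV. \<Sum>j\<in>UNIV - {i}. b i j * (x $ i - x $ j)\<^sup>2)"
    by (rule member_le_sum[of k UNIV "\<lambda>i. \<Sum>j\<in>UNIV - {i}. b i j * (x $ i - x $ j)\<^sup>2"])
      (auto intro!: sum_nonneg mult_nonneg_nonneg b_nonneg)
  finally show ?thesis by (simp add: quad_form_laplacian)
qed

text \<open>Every edge has positive weight, so a vanishing form makes the difference across each
  edge vanish. Induction along a path adds these differences up.\<close>

lemma laplacian_small_imp_consensus:
  assumes conn: "network_connected b"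
    and lim: "((\<lambda>t. quad_form (laplacian b) (x t)) \<longlongrightarrow> 0) F"
  shows "((\<lambda>t. x t $ i - x t $ j) \<longlongrightarrow> 0) F"
proof -
  have "(\<lambda>k l. k \<noteq> l \<and> b k l > 0)\<^sup>*\<^sup>* i j"
    using conn by (simp add: network_connected_def)
  then show ?thesis
  proof induction
    case (step k l)
    have "((\<lambda>t. 2 / b k l * quad_form (laplacian b) (x t)) \<longlongrightarrow> 2 / b k l * 0) F"
      by (intro tendsto_intros lim)
    then have upper: "((\<lambda>t. 2 / b k l * quad_form (laplacian b) (x t)) \<longlongrightarrow> 0) F"
      by simp
    have b: "k \<noteq> l" "0 < b k l" using step.hyps by auto
    have le: "(x t $ k - x t $ l)\<^sup>2 \<le> 2 / b k l * quad_form (laplacian b) (x t)" for t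
      using edge_le_quad_form_laplacian[OF b(1), of "x t"] b(2)
      by (simp add: pos_le_divide_eq mult.commute)
    have "((\<lambda>t. (x t $ k - x t $ l)\<^sup>2) \<longlongrightarrow> 0) F"
      by (rule tendsto_sandwich[OF always_eventually always_eventually tendsto_const upper])
        (blast intro: zero_le_power2 le)+
    from tendsto_real_sqrt[OF this] have "((\<lambda>t. x t $ k - x t $ l) \<longlongrightarrow> 0) F"
      by (simp add: tendsto_rabs_zero_iff)
    from tendsto_add[OF step.IH this] show ?case by simp
  qed simp
qed

end

subsection \<open>Decay of the network dynamics\<close>

lemma inner_diag_mat: "x \<bullet> (diag_mat a *v y) = (\<Sum>i\<in>UNIV. a $ i * (x $ i * y $ i))"
  by (simp add: inner_vec_def matrix_vector_mult_def diag_mat_def if_distrib[of "\<lambda>c. c * _"]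
      mult.left_commute cong: if_cong)

context
  fixes b :: "'n::finite \<Rightarrow> 'n \<Rightarrow> real" and d m :: "real^'n"
  assumes b_sym: "\<And>i j. i \<noteq> j \<Longrightarrow> b i j = b j i"
    and b_nonneg: "\<And>i j. i \<noteq> j \<Longrightarrow> 0 \<le> b i j"
    and connected: "network_connected b"
    and d_pos: "\<And>i. 0 < d $ i"
    and m_pos: "\<And>i. 0 < m $ i"
begin

lemma diag_mat_mult_inv: "diag_mat m ** (matrix_inv (diag_mat m) ** R) = R"
proof -
  have "m $ i \<noteq> 0" for i using m_pos[of i] by simp
  then show ?thesis
    by (simp add: matrix_mul_assoc matrix_inv_diag_mat diag_mat_mult diag_mat_one)
qed

text \<open>The factor \<open>diag_mat m\<close> cancels the inverse inertia, so the off-diagonal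
  blocks of the product are \<open>L\<close> and \<open>-L\<close> and disappear on adding the
  transpose. Only the damping block survives, twice.\<close>

lemma energy_lyapunov:
  "block_mat (laplacian b) 0 0 (diag_mat m) ** sys_A b d m
      + transpose (sys_A b d m) ** block_mat (laplacian b) 0 0 (diag_mat m)
    = - 2 *\<^sub>R block_mat 0 0 0 (diag_mat d)"
proof -
  let ?H = "block_mat (laplacian b) 0 0 (diag_mat m)"
  have L: "transpose (laplacian b) = laplacian b"
    using b_sym by (rule transpose_laplacian)
  have sym: "transpose ?H = ?H" by (simp add: transpose_block_mat transpose_zero L)
  have HA: "?H ** sys_A b d m = block_mat 0 (laplacian b) (- laplacian b) (- diag_mat d)"
    by (simp add: sys_A_def block_mat_mult matrix_mult_minus_right diag_mat_mult_inv)
  have AH: "transpose (sys_A b d m) ** ?H = transpose (?H ** sys_A b d m)"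
    by (simp add: matrix_transpose_mul sym)
  show ?thesis
    unfolding AH HA
    by (simp add: transpose_block_mat block_mat_add L transpose_uminus transpose_zero)
      (simp add: vec_eq_iff block_mat_def split: sum.split)
qed

text \<open>The cross term \<open>d \<theta>\<^sup>2 + 2 m \<theta> \<omega>\<close> added to the energy supplies the dissipation in the
  angles that the energy alone lacks.\<close>

lemma cross_term_lyapunov:
  "block_mat (diag_mat d) (diag_mat m) (diag_mat m) 0 ** sys_A b d m
      + transpose (sys_A b d m) ** block_mat (diag_mat d) (diag_mat m) (diag_mat m) 0
    = 2 *\<^sub>R block_mat (- laplacian b) 0 0 (diag_mat m)"
proof -
  let ?J = "block_mat (diag_mat d) (diag_mat m) (diag_mat m) 0"
  have L: "transpose (laplacian b) = laplacian b"
    using b_sym by (rule transpose_laplacian)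
  have sym: "transpose ?J = ?J" by (simp add: transpose_block_mat transpose_zero)
  have JA: "?J ** sys_A b d m = block_mat (- laplacian b) 0 0 (diag_mat m)"
    by (simp add: sys_A_def block_mat_mult matrix_mult_minus_right diag_mat_mult_inv)
  have AJ: "transpose (sys_A b d m) ** ?J = transpose (?J ** sys_A b d m)"
    by (simp add: matrix_transpose_mul sym)
  show ?thesis
    unfolding AJ JA
    by (simp add: transpose_block_mat block_mat_add L transpose_uminus transpose_zero)
      (simp add: vec_eq_iff block_mat_def split: sum.split)
qed

context
  fixes X :: "real \<Rightarrow> real^('n + 'n)"
  assumes flow: "\<And>t. (X has_vector_derivative sys_A b d m *v X t) (at t)"
begin

text \<open>With energy \<open>h = l + kin\<close> and cross term \<open>j\<close>, the derivatives
  are \<open>- 2 * diss\<close> and \<open>2 * (kin - l)\<close>. A small multiple of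
  \<open>j\<close> therefore makes the potential part \<open>l\<close> dissipate too, while the
  damping pays for the added \<open>kin\<close>.\<close>

lemma energy_decay:
  shows "((\<lambda>t. quad_form (block_mat (laplacian b) 0 0 (diag_mat m)) (X t)) \<longlongrightarrow> 0) at_top"
    and "\<exists>K. \<forall>t\<ge>0. \<forall>k. \<bar>X t $ Inl k\<bar> \<le> K"
proof -
  let ?\<theta> = "\<lambda>t. \<chi> k. X t $ Inl k"
  \<comment> \<open>The bound \<open>2 * \<epsilon> * m $ i \<le> d $ i\<close> is used twice: the
    damping dominates the kinetic term of the derivative of \<open>j\<close>, and
    \<open>h + \<epsilon> * j\<close> stays bounded below by squared angles.\<close>
  define \<epsilon> where "\<epsilon> = Min (range (\<lambda>i. d $ i / (2 * m $ i)))"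
  have \<epsilon>: "0 < \<epsilon>"
    using d_pos m_pos by (simp add: \<epsilon>_def)
  have \<epsilon>_le: "2 * \<epsilon> * m $ i \<le> d $ i" for i
  proof -
    have "\<epsilon> \<le> d $ i / (2 * m $ i)" by (simp add: \<epsilon>_def)
    then show ?thesis using m_pos[of i] by (simp add: field_simps)
  qed
  define h where "h t = quad_form (block_mat (laplacian b) 0 0 (diag_mat m)) (X t)" for t
  define j where "j t = quad_form (block_mat (diag_mat d) (diag_mat m) (diag_mat m) 0) (X t)" for t
  define l where "l t = quad_form (laplacian b) (?\<theta> t)" for t
  define kin where "kin t = (\<Sum>i\<in>UNIV. m $ i * (X t $ Inr i)\<^sup>2)" for t
  define diss where "diss t = (\<Sum>i\<in>UNIV. d $ i * (X t $ Inr i)\<^sup>2)" for t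
  have l: "0 \<le> l t" for t
    unfolding l_def using b_sym b_nonneg by (rule quad_form_laplacian_nonneg)
  have kin: "0 \<le> kin t" for t
    using m_pos by (auto simp: kin_def intro!: sum_nonneg mult_nonneg_nonneg simp: less_imp_le)
  have diss: "2 * \<epsilon> * kin t \<le> diss t" for t
    unfolding kin_def diss_def sum_distrib_left
  proof (rule sum_mono)
    fix i show "2 * \<epsilon> * (m $ i * (X t $ Inr i)\<^sup>2) \<le> d $ i * (X t $ Inr i)\<^sup>2"
      using mult_right_mono[OF \<epsilon>_le[of i], of "(X t $ Inr i)\<^sup>2"] by (simp add: mult_ac)
  qed
  have h: "h t = l t + kin t" for t
    by (simp add: h_def l_def kin_def quad_form_block_mat quad_form_diag)
  have j: "j t = (\<Sum>i\<in>UNIV. d $ i * (X t $ Inl i)\<^sup>2 + 2 * m $ i * (X t $ Inl i * X t $ Inr i))" for t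
    by (simp add: j_def quad_form_block_mat quad_form_diag inner_diag_mat sum.distrib[symmetric] algebra_simps)
  have h': "(h has_real_derivative - 2 * diss t) (at t)" for t
    using quad_form_flow_deriv[OF flow[of t], of "block_mat (laplacian b) 0 0 (diag_mat m)"]
    unfolding energy_lyapunov quad_form_scaleR quad_form_block_mat quad_form_diag
    by (simp add: h_def[abs_def] diss_def quad_form_block_mat quad_form_diag)
  have j': "(j has_real_derivative 2 * (kin t - l t)) (at t)" for t
    using quad_form_flow_deriv[OF flow[of t], of "block_mat (diag_mat d) (diag_mat m) (diag_mat m) 0"]
    unfolding cross_term_lyapunov quad_form_scaleR j_def[abs_def, symmetric]
    by (simp add: kin_def l_def quad_form_block_mat quad_form_diag quad_form_minus)
  have lower: "\<epsilon> / 2 * (d $ k * (X t $ Inl k)\<^sup>2) \<le> h t + \<epsilon> * j t" for t k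
  proof -
    have summand: "\<epsilon> / 2 * (d $ i * (X t $ Inl i)\<^sup>2) \<le> m $ i * (X t $ Inr i)\<^sup>2
        + \<epsilon> * (d $ i * (X t $ Inl i)\<^sup>2 + 2 * m $ i * (X t $ Inl i * X t $ Inr i))" for i
    proof -
      let ?q = "X t $ Inl i" and ?w = "X t $ Inr i" and ?m = "m $ i" and ?d = "d $ i"
      \<comment> \<open>Completing the square absorbs the mixed term; by the choice of \<epsilon>
        this costs at most half of the \<open>d\<close> term in the angle, and the other half is the
        lower bound.\<close>
      have "0 \<le> (\<epsilon> * ?m * ?q + ?m * ?w)\<^sup>2" by simp
      also have "\<dots> = ?m * (\<epsilon> * (\<epsilon> * ?m) * ?q\<^sup>2 + 2 * \<epsilon> * ?m * (?q * ?w) + ?m * ?w\<^sup>2)"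
        by (simp add: power2_eq_square algebra_simps)
      finally have "0 \<le> \<epsilon> * (\<epsilon> * ?m) * ?q\<^sup>2 + 2 * \<epsilon> * ?m * (?q * ?w) + ?m * ?w\<^sup>2"
        using m_pos[of i] by (simp add: zero_le_mult_iff)
      also have "\<epsilon> * (\<epsilon> * ?m) * ?q\<^sup>2 \<le> \<epsilon> * (?d / 2) * ?q\<^sup>2"
        using \<epsilon>_le[of i] \<epsilon> by (intro mult_right_mono mult_left_mono) auto
      finally show ?thesis by (simp add: algebra_simps)
    qed
    have "\<epsilon> / 2 * (d $ k * (X t $ Inl k)\<^sup>2) \<le> (\<Sum>i\<in>UNIV. \<epsilon> / 2 * (d $ i * (X t $ Inl i)\<^sup>2))"
      using \<epsilon> d_pos by (intro member_le_sum) (auto intro!: mult_nonneg_nonneg simp: less_imp_le)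
    also have "\<dots> \<le> (\<Sum>i\<in>UNIV. m $ i * (X t $ Inr i)\<^sup>2
        + \<epsilon> * (d $ i * (X t $ Inl i)\<^sup>2 + 2 * m $ i * (X t $ Inl i * X t $ Inr i)))"
      by (rule sum_mono) (rule summand)
    also have "\<dots> = kin t + \<epsilon> * j t"
      unfolding j kin_def sum.distrib[of "\<lambda>i. m $ i * (X t $ Inr i)\<^sup>2"] sum_distrib_left[of \<epsilon>] ..
    finally show ?thesis using l[of t] h[of t] by linarith
  qed
  have nonneg: "0 \<le> h t + \<epsilon> * j t" for t
    \<comment> \<open>Types are nonempty, so \<open>undefined\<close> serves as some node.\<close>
    using lower[of undefined t] \<epsilon> d_pos[of undefined] zero_le_power2[of "X t $ Inl undefined"]
    by (smt (verit) mult_nonneg_nonneg half_gt_zero)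
  txt \<open>Since \<open>h\<close> decreases and \<open>h + \<epsilon> j\<close> decreases at rate at least \<open>2 \<epsilon> h\<close>, the sum
    \<open>h + \<epsilon> j + 2 \<epsilon> t h\<close> is nonincreasing; this bounds \<open>\<theta>\<close> and gives \<open>h = O(1/t)\<close>.\<close>

  have upper: "h t + \<epsilon> * j t + 2 * \<epsilon> * t * h t \<le> h 0 + \<epsilon> * j 0" if "0 \<le> t" for t
  proof -
    have "h t + \<epsilon> * j t + 2 * \<epsilon> * t * h t \<le> h 0 + \<epsilon> * j 0 + 2 * \<epsilon> * 0 * h 0"
    proof (rule DERIV_nonpos_imp_nonincreasing[OF that])
      fix s :: real assume s: "0 \<le> s" "s \<le> t"
      have "((\<lambda>t. h t + \<epsilon> * j t + 2 * \<epsilon> * t * h t) has_real_derivative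
          - 2 * diss s + \<epsilon> * (2 * (kin s - l s)) + 2 * \<epsilon> * (h s + s * (- 2 * diss s))) (at s)"
        by (auto intro!: derivative_eq_intros h' j' simp: algebra_simps)
      moreover have "0 \<le> \<epsilon> * (s * diss s)"
        using \<epsilon> s diss[of s] kin[of s] by (smt (verit) mult_nonneg_nonneg)
      \<comment> \<open>Since \<open>diss s\<close> is at least
        \<open>2 * \<epsilon> * kin s\<close>, the first two summands are at most
        \<open>- 2 * \<epsilon> * h s\<close>. This cancels the \<open>h s\<close> coming from the
        product rule, and the rest is nonpositive.\<close>
      then have "- 2 * diss s + \<epsilon> * (2 * (kin s - l s)) + 2 * \<epsilon> * (h s + s * (- 2 * diss s)) \<le> 0"
        using diss[of s] by (simp add: h algebra_simps)
      ultimately show "\<exists>y. ((\<lambda>t. h t + \<epsilon> * j t + 2 * \<epsilon> * t * h t) has_real_derivative y) (at s) \<and> y \<le> 0"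
        by blast
    qed
    then show ?thesis by simp
  qed
  define W where "W = h 0 + \<epsilon> * j 0"
  have h_nonneg: "0 \<le> h t" for t using h l kin by simp
  have h_le: "h t \<le> W / (2 * \<epsilon>) * inverse t" if "0 < t" for t
    using upper[of t] nonneg[of t] \<epsilon> that
    by (simp add: W_def field_simps)
  have "((\<lambda>t. W / (2 * \<epsilon>) * inverse t) \<longlongrightarrow> W / (2 * \<epsilon>) * 0) at_top"
    by (intro tendsto_intros tendsto_inverse_0_at_top filterlim_ident)
  then have lim: "((\<lambda>t. W / (2 * \<epsilon>) * inverse t) \<longlongrightarrow> 0) at_top" by simp
  show "((\<lambda>t. quad_form (block_mat (laplacian b) 0 0 (diag_mat m)) (X t)) \<longlongrightarrow> 0) at_top"
    unfolding h_def[symmetric]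
  proof (rule tendsto_sandwich[OF always_eventually _ tendsto_const lim])
    show "\<forall>\<^sub>F t in at_top. h t \<le> W / (2 * \<epsilon>) * inverse t"
      using eventually_gt_at_top[of 0] by eventually_elim (rule h_le)
  qed (simp add: h_nonneg)
  have bound: "\<bar>X t $ Inl k\<bar> \<le> (\<Sum>k\<in>UNIV. sqrt (2 * W / (\<epsilon> * d $ k)))" if "0 \<le> t" for t k
  proof -
    have "\<epsilon> / 2 * (d $ k * (X t $ Inl k)\<^sup>2) \<le> W"
      using lower[of k t] upper[OF that] \<epsilon> that h_nonneg[of t]
      by (smt (verit) W_def mult_nonneg_nonneg)
    then have "(X t $ Inl k)\<^sup>2 \<le> 2 * W / (\<epsilon> * d $ k)"
      using \<epsilon> d_pos[of k] by (simp add: field_simps)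
    then have "\<bar>X t $ Inl k\<bar> \<le> sqrt (2 * W / (\<epsilon> * d $ k))"
      using real_sqrt_le_mono by fastforce
    also have "\<dots> \<le> (\<Sum>k\<in>UNIV. sqrt (2 * W / (\<epsilon> * d $ k)))"
      using \<epsilon> d_pos nonneg[of 0]
      by (intro member_le_sum) (auto simp: W_def intro!: divide_nonneg_nonneg simp: less_imp_le)
    finally show ?thesis .
  qed
  then show "\<exists>K. \<forall>t\<ge>0. \<forall>k. \<bar>X t $ Inl k\<bar> \<le> K" by blast
qed

text \<open>The state is split into a consensus part along \<open>z0\<close> and a remainder tending
  to 0. The consensus coordinate is only known to be bounded, but \<open>P\<close> annihilates
  \<open>z0\<close>, so every surviving term contains the remainder.\<close>

lemma quad_form_vanishes:
  assumes Pz: "P *v z0 = 0"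
  shows "((\<lambda>t. quad_form P (X t)) \<longlongrightarrow> 0) at_top"
proof -
  let ?h = "\<lambda>t. quad_form (block_mat (laplacian b) 0 0 (diag_mat m)) (X t)"
  let ?\<theta> = "\<lambda>t. \<chi> k. X t $ Inl k"
  have h: "?h t = quad_form (laplacian b) (?\<theta> t) + (\<Sum>i\<in>UNIV. m $ i * (X t $ Inr i)\<^sup>2)" for t
    by (simp add: quad_form_block_mat quad_form_diag)
  have l: "0 \<le> quad_form (laplacian b) (?\<theta> t)" for t
    using b_sym b_nonneg by (rule quad_form_laplacian_nonneg)
  have kin: "m $ k * (X t $ Inr k)\<^sup>2 \<le> (\<Sum>i\<in>UNIV. m $ i * (X t $ Inr i)\<^sup>2)" for t k
    using m_pos
    by (intro member_le_sum[of k UNIV "\<lambda>i. m $ i * (X t $ Inr i)\<^sup>2"])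
      (auto intro!: mult_nonneg_nonneg simp: less_imp_le)
  have kin0: "0 \<le> m $ k * (X t $ Inr k)\<^sup>2" for t k
    using m_pos[of k] by simp
  have "((\<lambda>t. quad_form (laplacian b) (?\<theta> t)) \<longlongrightarrow> 0) at_top"
    by (rule tendsto_sandwich[OF always_eventually always_eventually tendsto_const energy_decay(1)])
      (use l kin kin0 in \<open>auto simp: h intro!: sum_nonneg\<close>)
  with b_sym b_nonneg connected
  have angle: "((\<lambda>t. X t $ Inl k - X t $ Inl i) \<longlongrightarrow> 0) at_top" for k i
    using laplacian_small_imp_consensus[where b = b and x = ?\<theta> and F = at_top and i = k and j = i]
    by simp
  have freq: "((\<lambda>t. X t $ Inr k) \<longlongrightarrow> 0) at_top" for k
  proof -
    have up: "((\<lambda>t. ?h t / m $ k) \<longlongrightarrow> 0) at_top"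
      using tendsto_divide[OF energy_decay(1) tendsto_const, of "m $ k"] m_pos[of k] by simp
    have "(X t $ Inr k)\<^sup>2 \<le> ?h t / m $ k" for t
      using l[of t] kin[of k t] h[of t] m_pos[of k] by (simp add: pos_le_divide_eq mult.commute)
    then have "((\<lambda>t. (X t $ Inr k)\<^sup>2) \<longlongrightarrow> 0) at_top"
      by (intro tendsto_sandwich[OF always_eventually always_eventually tendsto_const up]) auto
    from tendsto_real_sqrt[OF this] show ?thesis
      by (simp add: tendsto_rabs_zero_iff)
  qed
  \<comment> \<open>The angle of an arbitrary reference node serves as the consensus
    coordinate.\<close>
  let ?i = "undefined :: 'n"
  let ?c = "\<lambda>t. X t $ Inl ?i" and ?Y = "\<lambda>t. X t - X t $ Inl ?i *\<^sub>R z0"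
  have Y: "(?Y \<longlongrightarrow> 0) at_top"
  proof (rule vec_tendstoI)
    fix k :: "'n + 'n"
    show "((\<lambda>t. ?Y t $ k) \<longlongrightarrow> 0 $ k) at_top"
      using angle freq by (cases k) (simp_all add: z0_def)
  qed
  have PY: "((\<lambda>t. P *v ?Y t) \<longlongrightarrow> 0) at_top"
    using bounded_linear.tendsto[OF matrix_vector_mul_bounded_linear Y] by simp
  have "((\<lambda>t. ?Y t \<bullet> (P *v ?Y t)) \<longlongrightarrow> 0) at_top"
    using tendsto_inner[OF Y PY] by simp
  \<comment> \<open>As \<open>P\<close> may fail to be symmetric, \<open>z0\<close> need not be
    annihilated from the left. This term vanishes as a bounded factor times one tending to
    0.\<close>
  moreover have "((\<lambda>t. ?c t * (z0 \<bullet> (P *v ?Y t))) \<longlongrightarrow> 0) at_top"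
  proof -
    obtain K where K: "\<And>t. 0 \<le> t \<Longrightarrow> \<bar>?c t\<bar> \<le> K"
      using energy_decay(2) by blast
    have "Zfun (\<lambda>t. z0 \<bullet> (P *v ?Y t)) at_top"
      using tendsto_inner[OF tendsto_const PY, of z0] by (simp add: tendsto_Zfun_iff)
    moreover have "Bfun ?c at_top"
      by (rule BfunI[where K = K]) (use K in \<open>auto intro!: eventually_mono[OF eventually_ge_at_top[of 0]]\<close>)
    ultimately show ?thesis
      using bounded_bilinear.Bfun_prod_Zfun[OF bounded_bilinear_mult] by (auto simp: tendsto_Zfun_iff)
  qed
  ultimately have "((\<lambda>t. ?Y t \<bullet> (P *v ?Y t) + ?c t * (z0 \<bullet> (P *v ?Y t))) \<longlongrightarrow> 0 + 0) at_top"
    by (rule tendsto_add)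
  moreover have "quad_form P (X t) = ?Y t \<bullet> (P *v ?Y t) + ?c t * (z0 \<bullet> (P *v ?Y t))" for t
  proof -
    have "P *v ?Y t = P *v X t"
      by (simp add: matrix_vector_mult_diff_distrib matrix_vector_mult_scaleR Pz)
    then show ?thesis by (simp add: quad_form_def inner_diff_left)
  qed
  ultimately show ?thesis by simp
qed

end

section \<open>The H2 integral and its value\<close>

lemma sys_C_gram:
  "transpose (sys_C 0 (diag_mat d)) ** sys_C 0 (diag_mat d) = block_mat 0 0 0 (diag_mat d)"
proof -
  have "(\<chi> i. sqrt (d $ i) * sqrt (d $ i)) = d"
    using d_pos by (simp add: vec_eq_iff less_imp_le)
  then show ?thesis
    by (simp add: sys_C_def matrix_sqrt_zero matrix_sqrt_diag_mat d_pos less_imp_le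
        transpose_block_mat block_mat_mult diag_mat_mult transpose_zero)
qed

lemma h2_integrand_has_integral:
  assumes lyap: "P ** sys_A b d m + transpose (sys_A b d m) ** P
      + transpose (sys_C 0 (diag_mat d)) ** sys_C 0 (diag_mat d) = 0"
    and Pz: "P *v z0 = 0"
  shows "(h2_integrand (sys_A b d m) (sys_B v m) (sys_C 0 (diag_mat d)) has_integral
    allocation_objective v (m, P)) {0..}"
proof -
  let ?Q = "transpose (sys_C 0 (diag_mat d)) ** sys_C 0 (diag_mat d)"
  have "0 \<le> quad_form ?Q x" for x
    using d_pos by (auto simp: sys_C_gram quad_form_block_mat quad_form_diag
        intro!: sum_nonneg mult_nonneg_nonneg simp: less_imp_le)
  note int = lyapunov_has_integral[OF lyap this quad_form_vanishes[OF matrix_exp_flow_deriv Pz]]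
  show ?thesis
    unfolding h2_integrand_eq[abs_def] allocation_objective_def prod.case trace_congruence
    by (intro has_integral_sum int) auto
qed

text \<open>The energy dissipates at twice the rate measured by the output, hence the factor 1/2.
  \<open>z0\<close> is annihilated because the rows of the Laplacian sum to 0.\<close>

lemma half_energy_solves_lyapunov:
  defines "P \<equiv> (1 / 2) *\<^sub>R block_mat (laplacian b) 0 0 (diag_mat m)"
  shows "P ** sys_A b d m + transpose (sys_A b d m) ** P
      + transpose (sys_C 0 (diag_mat d)) ** sys_C 0 (diag_mat d) = 0"
    and "P *v z0 = 0"
proof -
  let ?H = "block_mat (laplacian b) 0 0 (diag_mat m)"
  have "P ** sys_A b d m + transpose (sys_A b d m) ** P
      = (1 / 2) *\<^sub>R (?H ** sys_A b d m + transpose (sys_A b d m) ** ?H)"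
    by (simp add: P_def scaleR_add_right matrix_scalar_ac scalar_matrix_assoc)
  then show "P ** sys_A b d m + transpose (sys_A b d m) ** P
      + transpose (sys_C 0 (diag_mat d)) ** sys_C 0 (diag_mat d) = 0"
    by (simp add: energy_lyapunov sys_C_gram)
  have "(?H *v z0) $ i = 0" for i
    by (cases i) (simp_all add: matrix_vector_mult_def sum_UNIV_sum block_mat_def z0_def
        laplacian_row_sum)
  then have "?H *v z0 = 0" by (simp add: vec_eq_iff)
  then show "P *v z0 = 0"
    by (simp add: P_def scaleR_matrix_vector_assoc[symmetric])
qed

text \<open>Column \<open>j\<close> of the input matrix has the single nonzero candidate
  \<open>sqrt (v $ j) / m $ j\<close>, at the frequency of node \<open>j\<close>. The Laplacian
  block sees nothing of it, and weighting its square by \<open>m $ j\<close> leaves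
  \<open>v $ j / m $ j\<close>.\<close>

lemma objective_half_energy:
  assumes v_nonneg: "\<And>i. 0 \<le> v $ i"
  shows "allocation_objective v (m, (1 / 2) *\<^sub>R block_mat (laplacian b) 0 0 (diag_mat m))
    = reduced_objective v m / 2"
proof -
  have m0: "m $ i \<noteq> 0" for i using m_pos[of i] by simp
  have col: "(\<chi> k. column j (sys_B v m) $ Inl k) = 0"
    "(\<chi> k. column j (sys_B v m) $ Inr k) = (\<chi> k. if k = j then sqrt (v $ k) / m $ k else 0)" for j
    by (simp_all add: vec_eq_iff column_def sys_B_def block_col_def matrix_sqrt_diag_mat v_nonneg
        matrix_inv_diag_mat m0 diag_mat_mult)
      (simp_all add: diag_mat_def)
  have "m $ j * (sqrt (v $ j) / m $ j)\<^sup>2 = v $ j / m $ j" for j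
    using m0[of j] v_nonneg[of j] by (simp add: power_divide power2_eq_square)
  then have "quad_form (block_mat (laplacian b) 0 0 (diag_mat m)) (column j (sys_B v m)) = v $ j / m $ j" for j
    by (simp add: quad_form_block_mat col quad_form_diag if_distrib[of "\<lambda>c. c\<^sup>2"]
        if_distrib[of "\<lambda>c. _ * c"] cong: if_cong)
      (simp add: quad_form_def)
  then show ?thesis
    by (simp add: allocation_objective_def trace_congruence quad_form_scaleR reduced_objective_def
        sum_divide_distrib mult.commute)
qed

text \<open>The H2 integrand does not mention \<open>P\<close>, so uniqueness of the integral forces
  the value of the half energy on every feasible \<open>P\<close>, with no uniqueness of
  \<open>P\<close> itself.\<close>

lemma objective_eq_reduced:
  assumes v_nonneg: "\<And>i. 0 \<le> v $ i"
    and lyap: "P ** sys_A b d m + transpose (sys_A b d m) ** P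
      + transpose (sys_C 0 (diag_mat d)) ** sys_C 0 (diag_mat d) = 0"
    and Pz: "P *v z0 = 0"
  shows "allocation_objective v (m, P) = reduced_objective v m / 2"
  using has_integral_unique[OF h2_integrand_has_integral[OF lyap Pz]
      h2_integrand_has_integral[OF half_energy_solves_lyapunov]]
    objective_half_energy[OF v_nonneg]
  by metis

end

subsection \<open>The allocation problem\<close>

lemma convex_inertia_set: "convex (inertia_set lo hi bdg)"
proof -
  have "inertia_set lo hi bdg
      = {m. (\<chi> i. 1) \<bullet> m \<le> bdg} \<inter> (\<Inter>i. {m. axis i 1 \<bullet> m \<le> hi $ i} \<inter> {m. axis i 1 \<bullet> m \<ge> lo $ i})"
    by (auto simp: inertia_set_def inner_vec_def[of "\<chi> i. 1"] inner_axis')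
  also have "convex \<dots>"
    by (intro convex_Int convex_INT convex_halfspace_le convex_halfspace_ge)
  finally show ?thesis .
qed

text \<open>The objective is a combination, with nonnegative weights \<open>v $ i\<close>, of
  reciprocals, each convex on the positive half line.\<close>

lemma convex_on_reduced_objective:
  assumes "convex S" and pos: "\<And>m i. m \<in> S \<Longrightarrow> 0 < m $ i" and v_nonneg: "\<And>i. 0 \<le> v $ i"
  shows "convex_on S (reduced_objective v)"
proof (rule convex_onI)
  fix t x y assume t: "0 < t" "t < (1 :: real)" and xy: "x \<in> S" "y \<in> S"
  have inv: "convex_on {0 :: real<..} inverse" by (rule convex_on_inverse) auto
  have "v $ i / ((1 - t) *\<^sub>R x + t *\<^sub>R y) $ i \<le> (1 - t) * (v $ i / x $ i) + t * (v $ i / y $ i)" for i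
    using mult_left_mono[OF convex_onD[OF inv, of t "x $ i" "y $ i"] v_nonneg[of i]] t xy pos
    by (simp add: divide_inverse algebra_simps)
  then show "reduced_objective v ((1 - t) *\<^sub>R x + t *\<^sub>R y)
      \<le> (1 - t) * reduced_objective v x + t * reduced_objective v y"
    by (simp add: reduced_objective_def sum_distrib_left sum.distrib[symmetric] sum_mono)
qed (rule assms)

text \<open>Integrability is asserted beside the value of the H2 norm because
  \<open>integral\<close> is 0 on non-integrable functions.\<close>

theorem theorem3:
  fixes b :: "'n::finite \<Rightarrow> 'n \<Rightarrow> real"
    and d v lo hi :: "real^'n"
    and bdg :: real
  assumes b_sym: "\<And>i j. i \<noteq> j \<Longrightarrow> b i j = b j i"
    and b_nonneg: "\<And>i j. i \<noteq> j \<Longrightarrow> 0 \<le> b i j"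
    and connected: "network_connected b"
    and d_pos: "\<And>i. 0 < d $ i"
    and v_nonneg: "\<And>i. 0 \<le> v $ i"
    and lo_pos: "\<And>i. 0 < lo $ i"
    and lo_le_hi: "\<And>i. lo $ i \<le> hi $ i"
  shows "(\<forall>(m, P)\<in>allocation_feasible b d 0 (diag_mat d) lo hi bdg.
            h2_integrand (sys_A b d m) (sys_B v m) (sys_C 0 (diag_mat d)) integrable_on {0..} \<and>
            h2_norm_sq (sys_A b d m) (sys_B v m) (sys_C 0 (diag_mat d))
              = allocation_objective v (m, P)) \<and>
         convex (inertia_set lo hi bdg) \<and>
         convex_on (inertia_set lo hi bdg) (reduced_objective v) \<and>
         (\<forall>m. (\<exists>P. is_arg_min (allocation_objective v)
                    (\<lambda>x. x \<in> allocation_feasible b d 0 (diag_mat d) lo hi bdg) (m, P))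
              \<longleftrightarrow> is_arg_min (reduced_objective v) (\<lambda>x. x \<in> inertia_set lo hi bdg) m)"
proof -
  let ?F = "allocation_feasible b d 0 (diag_mat d) lo hi bdg"
  let ?P = "\<lambda>m. (1 / 2) *\<^sub>R block_mat (laplacian b) 0 0 (diag_mat m)"
  have m_pos: "0 < m $ i" if "m \<in> inertia_set lo hi bdg" for m i
    using that lo_pos[of i] by (auto simp: inertia_set_def intro: less_le_trans)
  have integral: "(h2_integrand (sys_A b d m) (sys_B v m) (sys_C 0 (diag_mat d)) has_integral
      allocation_objective v (m, P)) {0..}"
    and objective: "allocation_objective v (m, P) = reduced_objective v m / 2"
    if "(m, P) \<in> ?F" for m P
  proof -
    have m: "m \<in> inertia_set lo hi bdg" and Pz: "P *v z0 = 0"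
      and lyap: "P ** sys_A b d m + transpose (sys_A b d m) ** P
        + transpose (sys_C 0 (diag_mat d)) ** sys_C 0 (diag_mat d) = 0"
      using that by (auto simp: allocation_feasible_def)
    show "(h2_integrand (sys_A b d m) (sys_B v m) (sys_C 0 (diag_mat d)) has_integral
      allocation_objective v (m, P)) {0..}"
      using b_sym b_nonneg connected d_pos m_pos[OF m] lyap Pz by (rule h2_integrand_has_integral)
    show "allocation_objective v (m, P) = reduced_objective v m / 2"
      using b_sym b_nonneg connected d_pos m_pos[OF m] v_nonneg lyap Pz by (rule objective_eq_reduced)
  qed
  have feasible: "(m, ?P m) \<in> ?F" if "m \<in> inertia_set lo hi bdg" for m
    using half_energy_solves_lyapunov[of b d m, OF b_sym b_nonneg connected d_pos m_pos[OF that]] that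
    by (simp add: allocation_feasible_def)
  have fst_feasible: "m \<in> inertia_set lo hi bdg" if "(m, P) \<in> ?F" for m P
    using that by (simp add: allocation_feasible_def)
  \<comment> \<open>On feasible pairs the objective is half of a function of \<open>m\<close> alone,
    and each admissible \<open>m\<close> extends to a feasible pair by \<open>?P m\<close>.
    Minimality therefore transfers both ways.\<close>
  have "(\<exists>P. is_arg_min (allocation_objective v) (\<lambda>x. x \<in> ?F) (m, P))
      \<longleftrightarrow> is_arg_min (reduced_objective v) (\<lambda>x. x \<in> inertia_set lo hi bdg) m" for m
  proof
    assume "\<exists>P. is_arg_min (allocation_objective v) (\<lambda>x. x \<in> ?F) (m, P)"
    then obtain P where P: "(m, P) \<in> ?F"
      and min: "\<And>x. x \<in> ?F \<Longrightarrow> allocation_objective v (m, P) \<le> allocation_objective v x"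
      by (auto simp: is_arg_min_linorder)
    have "reduced_objective v m \<le> reduced_objective v m'" if "m' \<in> inertia_set lo hi bdg" for m'
      using min[OF feasible[OF that]] objective[OF P] objective[OF feasible[OF that]] by simp
    then show "is_arg_min (reduced_objective v) (\<lambda>x. x \<in> inertia_set lo hi bdg) m"
      using fst_feasible[OF P] by (simp add: is_arg_min_linorder)
  next
    assume "is_arg_min (reduced_objective v) (\<lambda>x. x \<in> inertia_set lo hi bdg) m"
    then have m: "m \<in> inertia_set lo hi bdg"
      and min: "\<And>m'. m' \<in> inertia_set lo hi bdg \<Longrightarrow> reduced_objective v m \<le> reduced_objective v m'"
      by (auto simp: is_arg_min_linorder)
    have "allocation_objective v (m, ?P m) \<le> allocation_objective v x" if "x \<in> ?F" for x
      using that min[OF fst_feasible, of "fst x" "snd x"] objective[of "fst x" "snd x"]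
        objective[OF feasible[OF m]] by simp
    then have "is_arg_min (allocation_objective v) (\<lambda>x. x \<in> ?F) (m, ?P m)"
      using feasible[OF m] by (simp add: is_arg_min_linorder)
    then show "\<exists>P. is_arg_min (allocation_objective v) (\<lambda>x. x \<in> ?F) (m, P)" by blast
  qed
  moreover have "convex_on (inertia_set lo hi bdg) (reduced_objective v)"
    using convex_inertia_set m_pos v_nonneg by (rule convex_on_reduced_objective)
  moreover have "h2_norm_sq (sys_A b d m) (sys_B v m) (sys_C 0 (diag_mat d))
      = allocation_objective v (m, P)" if "(m, P) \<in> ?F" for m P
    unfolding h2_norm_sq_def using integral[OF that] by (rule integral_unique)
  moreover have "h2_integrand (sys_A b d m) (sys_B v m) (sys_C 0 (diag_mat d)) integrable_on {0..}"
    if "(m, P) \<in> ?F" for m P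
    using integral[OF that] by (rule has_integral_integrable)
  ultimately show ?thesis
    using convex_inertia_set by blast
qed

end
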